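(* Let $0\le k<1$ and $M\ge 0$ with $k+M<1$, and let $f=h+\overline{g}\in\mathcal{H}^0_{k,M}$. Then $f(\mathbb{D})$ contains a schlicht disk of radius at least $$B_{k,M}=\frac{3(1-k-M)^2}{128}.$$
   Context: $\mathbb{D}=\{z\in\mathbb{C}:|z|<1\}$. For an analytic function $\varphi$ in $\mathbb{D}$, $\|\varphi\|_\infty=\sup_{z\in\mathbb{D}}|\varphi(z)|$. Class $\mathcal{H}_{k,M}$ ($0\le k<1$, $M\ge 0$): the harmonic mappings $f=h+\overline{g}$ in $\mathbb{D}$ such that (1) $h$ and $g$ are analytic in $\mathbb{D}$; (2) $g(0)=0$; (3) there exist analytic functions $\omega,\psi$ in $\mathbb{D}$ such that $g'(z)=\omega(z)h'(z)+\psi(z)$ for all $z\in\mathbb{D}$; (4) $\|\omega\|_\infty\le k$ and $\|\psi\|_\infty\le M$; (5) $f$ is sense-preserving, i.e. $|g'(z)|<|h'(z)|$ for all $z\in\mathbb{D}$. Class $\mathcal{H}^0_{k,M}$: those $f=h+\overline{g}\in\mathcal{H}_{k,M}$ satisfying $f(0)=0$, $h'(0)=1$ and $g(0)=0$. A disk $D\subset\mathbb{C}$ is a schlicht disk for $f$ (contained in $f(\mathbb{D})$) if there exists a region $\Omega\subset\mathbb{D}$ such that $f$ is univalent (injective) on $\Omega$ and $f(\Omega)=D$. *)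

theory Defs
  imports "HOL-Analysis.Analysis"
begin

abbreviation unit_disc :: "complex set" where
  "unit_disc \<equiv> ball 0 1"

text \<open>The supremum is taken in the extended reals, so that it is infinite (rather than an
  unspecified real number) for unbounded functions.\<close>

definition disc_norm :: "(complex \<Rightarrow> complex) \<Rightarrow> ereal" where
  "disc_norm \<phi> = (SUP z\<in>unit_disc. ereal (norm (\<phi> z)))"

text \<open>Functions are total on the complex plane; only their values on the unit disc matter.
  The decomposition is a parameter of the following predicate because the normalisation of the
  second class below constrains the derivative of the analytic part \<open>h\<close>.\<close>

definition harmonic_decomp ::
  "real \<Rightarrow> real \<Rightarrow> (complex \<Rightarrow> complex) \<Rightarrow> (complex \<Rightarrow> complex) \<Rightarrow> (complex \<Rightarrow> complex) \<Rightarrow> bool" where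
  "harmonic_decomp k M f h g \<longleftrightarrow>
     (\<forall>z\<in>unit_disc. f z = h z + cnj (g z)) \<and>
     h holomorphic_on unit_disc \<and> g holomorphic_on unit_disc \<and>
     g 0 = 0 \<and>
     (\<exists>\<omega> \<psi>. \<omega> holomorphic_on unit_disc \<and> \<psi> holomorphic_on unit_disc \<and>
        (\<forall>z\<in>unit_disc. deriv g z = \<omega> z * deriv h z + \<psi> z) \<and>
        disc_norm \<omega> \<le> ereal k \<and> disc_norm \<psi> \<le> ereal M) \<and>
     (\<forall>z\<in>unit_disc. norm (deriv g z) < norm (deriv h z))"

definition harmonic_class :: "real \<Rightarrow> real \<Rightarrow> (complex \<Rightarrow> complex) set" where
  "harmonic_class k M = {f. \<exists>h g. harmonic_decomp k M f h g}"

definition harmonic_class0 :: "real \<Rightarrow> real \<Rightarrow> (complex \<Rightarrow> complex) set" where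
  "harmonic_class0 k M =
     {f \<in> harmonic_class k M.
        \<exists>h g. harmonic_decomp k M f h g \<and> f 0 = 0 \<and> deriv h 0 = 1 \<and> g 0 = 0}"

text \<open>Discs are open and nondegenerate; a region is a nonempty open connected set.\<close>

definition schlicht_disc :: "(complex \<Rightarrow> complex) \<Rightarrow> complex \<Rightarrow> real \<Rightarrow> bool" where
  "schlicht_disc f w r \<longleftrightarrow>
     r > 0 \<and>
     (\<exists>\<Omega>. \<Omega> \<noteq> {} \<and> open \<Omega> \<and> connected \<Omega> \<and> \<Omega> \<subseteq> unit_disc \<and>
        inj_on f \<Omega> \<and> f ` \<Omega> = ball w r)"

end

theory Submission
  imports Defs "HOL-Complex_Analysis.Conformal_Mappings"
begin

text \<open>
  Landau's argument: choose \<open>c\<close> maximising \<open>(3/4 - |z|) |h'(z)|\<close> on the closed disc of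
  radius \<open>3/4\<close>. With \<open>a = |h'(c)| \<ge> 1\<close> and \<open>t = (3/4 - |c|)/2\<close> this gives
  \<open>a t \<ge> 3/8\<close> and \<open>|g'| < |h'| \<le> 2a\<close> on the disc of radius \<open>t\<close> about \<open>c\<close>, while
  \<open>|h'(c)| - |g'(c)| \<ge> a - (k a + M) \<ge> (1 - k - M) a\<close>. By the Schwarz lemma \<open>h'\<close> and
  \<open>g'\<close> each differ from their value at \<open>c\<close> by at most \<open>4a |z - c| / t\<close>, so \<open>f\<close> is close
  enough to its real-linear part at \<open>c\<close> to be injective on the disc of radius
  \<open>(1 - k - M) t / 8\<close> and to cover a disc of radius \<open>(1 - k - M)\<^sup>2 a t / 16\<close>.
\<close>

text \<open>Rescaling \<open>ball c t\<close> to the unit disc and dividing by \<open>K\<close>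
  turns this into the classical Schwarz lemma. The bound by \<open>K\<close> is strict because that
  lemma wants values in the open disc; at the centre it forces \<open>K > 0\<close>.\<close>

lemma Schwarz_ball:
  assumes hol: "F holomorphic_on ball c t" and t: "t > 0" and F0: "F c = 0"
    and K: "\<And>z. z \<in> ball c t \<Longrightarrow> norm (F z) < K" and z: "z \<in> ball c t"
  shows "norm (F z) \<le> K * norm (z - c) / t"
proof -
  have K0: "K > 0" using K[of c] t F0 by simp
  define G where "G w = F (c + of_real t * w) / of_real K" for w
  have mem: "c + of_real t * w \<in> ball c t" if "norm w < 1" for w
    using that t by (simp add: dist_norm norm_mult)
  have "(F \<circ> (\<lambda>w. c + of_real t * w)) holomorphic_on ball 0 1"
    by (rule holomorphic_on_compose_gen[OF _ hol]) (auto intro!: holomorphic_intros mem simp del: mem_ball)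
  then have 1: "G holomorphic_on ball 0 1"
    unfolding G_def o_def using K0 by (intro holomorphic_intros) auto
  have 2: "G 0 = 0" by (simp add: G_def F0)
  have 3: "norm (G w) < 1" if "norm w < 1" for w
    using K[OF mem[OF that]] K0 by (simp add: G_def norm_divide)
  have n: "norm ((z - c) / of_real t) < 1"
    using z t by (simp add: norm_divide dist_norm norm_minus_commute)
  have "norm (G ((z - c) / of_real t)) \<le> norm ((z - c) / of_real t)"
    by (rule Schwarz_Lemma(1)[OF 1 2 3 n])
  then show ?thesis
    using t K0 by (simp add: G_def norm_divide field_simps)
qed

text \<open>Mean value inequality on a convex disc for \<open>F\<close> minus its linear part. The
  bound in terms of \<open>z - w\<close> for arbitrary pairs of points serves injectivity.\<close>

lemma linear_remainder_lipschitz: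
  assumes hol: "F holomorphic_on ball c t" and t: "t > 0" and K: "K \<ge> 0"
    and d: "\<And>z. z \<in> ball c t \<Longrightarrow> norm (deriv F z - deriv F c) \<le> K * norm (z - c) / t"
    and zw: "z \<in> cball c s" "w \<in> cball c s" and s: "s < t"
  shows "norm ((F z - deriv F c * z) - (F w - deriv F c * w)) \<le> K * s / t * norm (z - w)"
proof (rule field_differentiable_bound[OF convex_cball _ _ zw])
  fix x assume x: "x \<in> cball c s"
  then have xt: "x \<in> ball c t" using s by auto
  show "((\<lambda>z. F z - deriv F c * z) has_field_derivative (deriv F x - deriv F c))
      (at x within cball c s)"
    by (auto intro!: derivative_eq_intros DERIV_subset[OF holomorphic_derivI[OF hol open_ball xt]])
  have "K * norm (x - c) / t \<le> K * s / t"
    using x K t by (intro divide_right_mono mult_left_mono) (auto simp: dist_norm norm_minus_commute)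
  with d[OF xt] show "norm (deriv F x - deriv F c) \<le> K * s / t" by linarith
qed

text \<open>The bound on the derivative grows linearly along the segment from \<open>c\<close> to
  \<open>z\<close>, so integrating it gains a factor 1/2 over the Lipschitz estimate. This factor is
  what leaves a positive covering radius later.\<close>

lemma linear_remainder_quadratic:
  assumes hol: "F holomorphic_on ball c t" and t: "t > 0"
    and d: "\<And>z. z \<in> ball c t \<Longrightarrow> norm (deriv F z - deriv F c) \<le> K * norm (z - c) / t"
    and z: "z \<in> ball c t"
  shows "norm (F z - F c - deriv F c * (z - c)) \<le> K * (norm (z - c))\<^sup>2 / (2 * t)"
proof -
  define p where "p s = c + of_real s * (z - c)" for s :: real
  define R where "R s = F (p s) - deriv F c * p s" for s
  have p: "p s \<in> ball c t" if "0 \<le> s" "s \<le> 1" for s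
  proof -
    have "s * norm (z - c) \<le> norm (z - c)"
      using that by (simp add: mult_left_le_one_le)
    with z that show ?thesis by (simp add: p_def dist_norm norm_mult norm_minus_commute)
  qed
  have R': "(R has_vector_derivative (z - c) * (deriv F (p s) - deriv F c)) (at s)"
    if "0 \<le> s" "s \<le> 1" for s
  proof -
    have 1: "(p has_vector_derivative (z - c)) (at s)"
      unfolding p_def by (auto intro!: derivative_eq_intros simp: has_vector_derivative_def scaleR_conv_of_real)
    have 2: "((\<lambda>x. F x - deriv F c * x) has_field_derivative (deriv F (p s) - deriv F c)) (at (p s))"
      by (auto intro!: derivative_eq_intros holomorphic_derivI[OF hol open_ball p[OF that]])
    from field_vector_diff_chain_at[OF 1 2] show ?thesis by (simp add: R_def[abs_def] o_def)
  qed
  have "norm (R 1 - R 0) \<le> K * (norm (z - c))\<^sup>2 / (2 * t) * 1\<^sup>2 - K * (norm (z - c))\<^sup>2 / (2 * t) * 0\<^sup>2"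
  proof (rule differentiable_bound_general[where \<phi> = "\<lambda>s. K * (norm (z - c))\<^sup>2 / (2 * t) * s\<^sup>2"
        and \<phi>' = "\<lambda>s. K * (norm (z - c))\<^sup>2 / (2 * t) * (2 * s)"])
    show "continuous_on {0..1} R"
      by (intro continuous_at_imp_continuous_on ballI has_vector_derivative_continuous[OF R']) auto
    show "continuous_on {0..1} (\<lambda>s. K * (norm (z - c))\<^sup>2 / (2 * t) * s\<^sup>2)"
      by (intro continuous_intros)
    fix s :: real assume s: "0 < s" "s < 1"
    then show "(R has_vector_derivative (z - c) * (deriv F (p s) - deriv F c)) (at s)"
      by (intro R') auto
    show "((\<lambda>s. K * (norm (z - c))\<^sup>2 / (2 * t) * s\<^sup>2) has_vector_derivative
        K * (norm (z - c))\<^sup>2 / (2 * t) * (2 * s)) (at s)"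
      unfolding has_real_derivative_iff_has_vector_derivative[symmetric]
      by (rule derivative_eq_intros refl | simp)+
    have "norm (deriv F (p s) - deriv F c) \<le> K * (s * norm (z - c)) / t"
      using d[OF p[of s]] s by (simp add: p_def norm_mult)
    then have "norm (z - c) * norm (deriv F (p s) - deriv F c)
        \<le> norm (z - c) * (K * (s * norm (z - c)) / t)"
      by (intro mult_left_mono) auto
    then show "norm ((z - c) * (deriv F (p s) - deriv F c))
        \<le> K * (norm (z - c))\<^sup>2 / (2 * t) * (2 * s)"
      unfolding norm_mult by (simp add: power2_eq_square mult_ac)
  qed simp
  then show ?thesis by (simp add: R_def p_def algebra_simps)
qed

text \<open>The real-linear map with coefficients \<alpha>, \<beta> shrinks lengths by no more than
  the difference of their moduli, by the reverse triangle inequality.\<close>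

lemma norm_linear_harmonic_ge:
  fixes \<alpha> \<beta> u :: complex
  assumes "A \<le> norm \<alpha> - norm \<beta>"
  shows "A * norm u \<le> norm (\<alpha> * u + cnj (\<beta> * u))"
proof -
  have "A * norm u \<le> (norm \<alpha> - norm \<beta>) * norm u"
    using assms by (intro mult_right_mono) auto
  also have "\<dots> = norm (\<alpha> * u) - norm (cnj (\<beta> * u))"
    by (simp add: norm_mult left_diff_distrib)
  also have "\<dots> \<le> norm (\<alpha> * u + cnj (\<beta> * u))"
    by (rule norm_diff_ineq)
  finally show ?thesis .
qed

text \<open>The radius \<open>s\<close> solves \<open>2 * K * s / t = A\<close>: there the Lipschitz
  constants \<open>K * s / t\<close> of the two remainders together balance the lower bound
  \<open>A\<close> for the linear part. The condition \<open>A < 2 * K\<close> gives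
  \<open>s < t\<close>.\<close>

lemma harmonic_inj_and_covers:
  assumes h: "h holomorphic_on ball c t" and g: "g holomorphic_on ball c t"
    and t: "t > 0" and A: "0 < A" "A < 2 * K" "A \<le> norm (deriv h c) - norm (deriv g c)"
    and dh: "\<And>z. z \<in> ball c t \<Longrightarrow> norm (deriv h z - deriv h c) < K"
    and dg: "\<And>z. z \<in> ball c t \<Longrightarrow> norm (deriv g z - deriv g c) < K"
    and f: "\<And>z. z \<in> ball c t \<Longrightarrow> f z = h z + cnj (g z)"
    and s: "s = A * t / (2 * K)"
  shows "inj_on f (ball c s)" and "ball (f c) (A * s / 2) \<subseteq> f ` ball c s"
    and "continuous_on (ball c s) f"
proof -
  have K: "K > 0" using A by linarith
  have s0: "s > 0" and st: "s < t" using A t K by (auto simp: s field_simps)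
  have sub: "cball c s \<subseteq> ball c t" using st by auto
  have sh: "norm (deriv h z - deriv h c) \<le> K * norm (z - c) / t" if "z \<in> ball c t" for z
    by (rule Schwarz_ball[OF _ t _ dh that]) (auto intro!: holomorphic_intros holomorphic_deriv h)
  have sg: "norm (deriv g z - deriv g c) \<le> K * norm (z - c) / t" if "z \<in> ball c t" for z
    by (rule Schwarz_ball[OF _ t _ dg that]) (auto intro!: holomorphic_intros holomorphic_deriv g)
  have "continuous_on (ball c t) (\<lambda>z. h z + cnj (g z))"
    by (intro continuous_intros holomorphic_on_imp_continuous_on h g)
  then have contf: "continuous_on (ball c t) f"
    by (rule continuous_on_eq) (simp add: f)
  then show cs: "continuous_on (ball c s) f"
    by (rule continuous_on_subset) (use st in auto)
  show inj: "inj_on f (ball c s)"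
  proof (rule inj_onI, rule ccontr)
    fix z w assume zw: "z \<in> ball c s" "w \<in> ball c s" "f z = f w" "z \<noteq> w"
    \<comment> \<open>At radius \<open>s\<close> the two constants only balance. A closed disc of
      radius \<open>r < s\<close> containing both points makes the inequality strict.\<close>
    define r where "r = max (dist c z) (dist c w)"
    have r: "z \<in> cball c r" "w \<in> cball c r" "r < s" "r < t"
      using zw st by (auto simp: r_def)
    have "z \<in> ball c t" "w \<in> ball c t" using zw(1,2) st by auto
    with f zw(3) have fzw: "h z = h w + cnj (g w) - cnj (g z)"
      by (metis add_diff_cancel_right')
    let ?H = "(h z - deriv h c * z) - (h w - deriv h c * w)"
    let ?G = "(g z - deriv g c * z) - (g w - deriv g c * w)"
    let ?L = "deriv h c * (z - w) + cnj (deriv g c * (z - w))"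
    have eq: "?L = - (?H + cnj ?G)"
      using fzw by (simp add: algebra_simps)
    have "A * norm (z - w) \<le> norm ?L" by (rule norm_linear_harmonic_ge[OF A(3)])
    also have "\<dots> = norm (?H + cnj ?G)" unfolding eq norm_minus_cancel ..
    also have "\<dots> \<le> norm ?H + norm (cnj ?G)" by (rule norm_triangle_ineq)
    also have "\<dots> = norm ?H + norm ?G" by (simp only: complex_mod_cnj)
    also have "\<dots> \<le> K * r / t * norm (z - w) + K * r / t * norm (z - w)"
      using K t by (intro add_mono linear_remainder_lipschitz[OF h t _ sh r(1,2,4)]
        linear_remainder_lipschitz[OF g t _ sg r(1,2,4)]) auto
    finally have "A * norm (z - w) \<le> (2 * K * r / t) * norm (z - w)" by simp
    then have "A \<le> 2 * K * r / t"
      by (rule mult_right_le_imp_le) (use zw(4) in simp)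
    also have "\<dots> < 2 * K * s / t"
      using r K t by (intro divide_strict_right_mono mult_strict_left_mono) auto
    also have "\<dots> = A" using K t by (simp add: s)
    finally show False by simp
  qed
  have "ball (f c) (A * s / 2) \<subseteq> f ` ball c s"
  proof (rule ball_subset_open_map_image)
    show "continuous_on (closure (ball c s)) f"
      using s0 sub by (auto intro: continuous_on_subset[OF contf])
    \<comment> \<open>\<open>f\<close> is not holomorphic, so invariance of domain replaces the open
      mapping theorem.\<close>
    show "open (f ` interior (ball c s))"
      using invariance_of_domain[OF cs open_ball inj] by simp
    show "A * s / 2 \<le> norm (f z - f c)" if "z \<in> frontier (ball c s)" for z
    proof -
      have z: "norm (z - c) = s" "z \<in> ball c t"
        using that s0 st by (auto simp: dist_norm norm_minus_commute)
      let ?H = "h z - h c - deriv h c * (z - c)"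
      let ?G = "g z - g c - deriv g c * (z - c)"
      let ?L = "deriv h c * (z - c) + cnj (deriv g c * (z - c))"
      have eq: "?L = (f z - f c) - (?H + cnj ?G)"
        using f[OF z(2)] f[of c] t by (simp add: algebra_simps)
      have "A * s \<le> norm ?L" using norm_linear_harmonic_ge[OF A(3), of "z - c"] z by simp
      also have "\<dots> \<le> norm (f z - f c) + norm (?H + cnj ?G)" unfolding eq by (rule norm_triangle_ineq4)
      also have "norm (?H + cnj ?G) \<le> norm ?H + norm (cnj ?G)" by (rule norm_triangle_ineq)
      also have "\<dots> = norm ?H + norm ?G" by (simp only: complex_mod_cnj)
      also have "\<dots> \<le> K * s\<^sup>2 / (2 * t) + K * s\<^sup>2 / (2 * t)"
        using linear_remainder_quadratic[OF h t sh z(2)] linear_remainder_quadratic[OF g t sg z(2)]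
        unfolding z(1) by (rule add_mono)
      \<comment> \<open>The remainders use up half of \<open>A * s\<close>; the other half is the
        covering radius.\<close>
      also have "\<dots> = A * s / 2"
        using K t by (simp add: s power2_eq_square field_simps)
      finally show ?thesis by simp
    qed
  qed (use s0 A in auto)
  then show "ball (f c) (A * s / 2) \<subseteq> f ` ball c s" .
qed

text \<open>A schlicht disc needs a region mapped exactly onto it, so \<open>U\<close> is cut down
  to the preimage of the disc. That preimage is connected as the image of the disc under the inverse
  of \<open>f\<close>, which is continuous by invariance of domain.\<close>

lemma schlicht_discI:
  assumes inj: "inj_on f U" and cont: "continuous_on U f" and U: "open U" "U \<subseteq> unit_disc"
    and cov: "ball w r \<subseteq> f ` U" and r: "r > 0"
  shows "schlicht_disc f w r"
proof -
  let ?\<Omega> = "U \<inter> f -` ball w r"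
  obtain g where gf: "homeomorphism U (f ` U) f g"
    using invariance_of_domain_homeomorphism[OF U(1) cont _ inj] by auto
  have im: "f ` ?\<Omega> = ball w r" using cov by blast
  have "?\<Omega> = g ` ball w r"
  proof -
    have "g ` f ` ?\<Omega> = ?\<Omega>"
      using gf by (force simp: homeomorphism_def image_image)
    then show ?thesis unfolding im ..
  qed
  moreover have "continuous_on (ball w r) g"
    using gf cov by (auto simp: homeomorphism_def intro: continuous_on_subset)
  ultimately have "connected ?\<Omega>"
    by (metis connected_ball connected_continuous_image)
  moreover have "open ?\<Omega>"
    using continuous_open_preimage[OF cont U(1) open_ball] by simp
  moreover have "?\<Omega> \<noteq> {}"
  proof
    assume "?\<Omega> = {}"
    with im have "ball w r = {}" by (metis image_empty)
    with r show False by simp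
  qed
  moreover have "inj_on f ?\<Omega>" using inj by (auto intro: inj_on_subset)
  ultimately show ?thesis
    unfolding schlicht_disc_def
    by (intro conjI exI[of _ ?\<Omega>] r im le_infI1[OF U(2)])
qed

lemma disc_norm_leD:
  assumes "disc_norm \<phi> \<le> ereal C" and "z \<in> unit_disc"
  shows "norm (\<phi> z) \<le> C"
  using assms by (auto simp: disc_norm_def SUP_le_iff)

theorem theorem3p1:
  fixes k M :: real and f :: "complex \<Rightarrow> complex"
  assumes "0 \<le> k" and "k < 1" and "0 \<le> M" and "k + M < 1"
    and "f \<in> harmonic_class0 k M"
  shows "\<exists>w r. r \<ge> 3 * (1 - k - M)\<^sup>2 / 128 \<and> schlicht_disc f w r"
proof -
  obtain h g where hg: "harmonic_decomp k M f h g" and h1: "deriv h 0 = 1"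
    using assms(5) by (auto simp: harmonic_class0_def)
  then obtain \<omega> \<psi> where f: "\<And>z. z \<in> unit_disc \<Longrightarrow> f z = h z + cnj (g z)"
    and h: "h holomorphic_on unit_disc" and g: "g holomorphic_on unit_disc"
    and gd: "\<And>z. z \<in> unit_disc \<Longrightarrow> deriv g z = \<omega> z * deriv h z + \<psi> z"
    and om: "disc_norm \<omega> \<le> ereal k" and ps: "disc_norm \<psi> \<le> ereal M"
    and sp: "\<And>z. z \<in> unit_disc \<Longrightarrow> norm (deriv g z) < norm (deriv h z)"
    unfolding harmonic_decomp_def by blast
  define l where "l = 1 - k - M"
  have l: "0 < l" "l \<le> 1" using assms by (auto simp: l_def)
  have "continuous_on (cball 0 (3/4)) (deriv h)"
    by (rule continuous_on_subset[OF holomorphic_on_imp_continuous_on[OF holomorphic_deriv[OF h]]]) auto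
  then have "continuous_on (cball 0 (3/4)) (\<lambda>z. (3/4 - norm z) * norm (deriv h z))"
    by (intro continuous_intros)
  then obtain c where c: "c \<in> cball 0 (3/4)"
    and max: "\<And>z. z \<in> cball 0 (3/4) \<Longrightarrow>
      (3/4 - norm z) * norm (deriv h z) \<le> (3/4 - norm c) * norm (deriv h c)"
    using continuous_attains_sup[OF compact_cball, of 0 "3/4"] by force
  define a where "a = norm (deriv h c)"
  define t where "t = (3/4 - norm c) / 2"
  have cD: "c \<in> unit_disc" using c by auto
  \<comment> \<open>Comparison with the origin, where \<open>deriv h 0 = 1\<close>, gives
    \<open>3/4 \<le> 2 * t * a\<close>. In particular \<open>c\<close> is not on the boundary
    circle.\<close>
  have at: "3/8 \<le> a * t" using max[of 0] h1 by (simp add: a_def t_def mult.commute[of "cmod (deriv h c)"])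
  have "t \<noteq> 0" using at by auto
  then have t: "t > 0" using c by (simp add: t_def)
  have a1: "a \<ge> 1"
  proof -
    have "t \<le> 3/8" by (simp add: t_def)
    with at have "1 * t \<le> a * t" by linarith
    then show ?thesis using t mult_right_le_imp_le by blast
  qed
  \<comment> \<open>Since \<open>3/4 - norm c = 2 * t\<close>, moving by less than \<open>t\<close>
    still leaves a distance of at least \<open>t\<close> to the circle of radius 3/4. Maximality at
    \<open>c\<close> then loses only a factor 2 in the bound for \<open>deriv h\<close>.\<close>
  have small: "z \<in> unit_disc" "t \<le> 3/4 - norm z" if "z \<in> ball c t" for z
  proof -
    have "norm z \<le> norm c + norm (z - c)" by (metis norm_triangle_sub)
    moreover have "norm (z - c) < t" using that by (simp add: dist_norm norm_minus_commute)
    ultimately show "t \<le> 3/4 - norm z" by (simp add: t_def)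
    then show "z \<in> unit_disc" using t by simp
  qed
  have hb: "norm (deriv h z) \<le> 2 * a" if z: "z \<in> ball c t" for z
  proof -
    have "t * norm (deriv h z) \<le> (3/4 - norm z) * norm (deriv h z)"
      using small[OF z] by (intro mult_right_mono) auto
    also have "\<dots> \<le> t * (2 * a)"
      using max[of z] small(2)[OF z] t by (simp add: a_def t_def)
    finally show ?thesis using t by simp
  qed
  have gb: "norm (deriv g z) \<le> 2 * a" if "z \<in> ball c t" for z
    using hb[OF that] sp[OF small(1)[OF that]] by linarith
  have gc: "norm (deriv g c) < a" using sp[OF cD] by (simp add: a_def)
  have "norm (deriv g c) \<le> norm (\<omega> c) * a + norm (\<psi> c)"
    unfolding gd[OF cD] a_def by (metis norm_mult norm_triangle_ineq)
  also have "\<dots> \<le> k * a + M * a"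
  proof (rule add_mono)
    show "norm (\<omega> c) * a \<le> k * a"
      using disc_norm_leD[OF om cD] a1 by (intro mult_right_mono) auto
    \<comment> \<open>The additive term is absorbed into a multiple of \<open>a\<close> because
      \<open>a \<ge> 1\<close>.\<close>
    have "M * 1 \<le> M * a" using assms(3) a1 by (intro mult_left_mono) auto
    then show "norm (\<psi> c) \<le> M * a"
      using disc_norm_leD[OF ps cD] by linarith
  qed
  finally have A: "l * a \<le> norm (deriv h c) - norm (deriv g c)"
    by (simp add: l_def a_def algebra_simps)
  have la: "l * a \<le> a" using l a1 by simp
  \<comment> \<open>The previous lemma is applied with \<open>A = l * a\<close> and
    \<open>K = 4 * a\<close>: both derivatives differ from their values at \<open>c\<close> by at
    most \<open>2 * a + a\<close>, strictly below \<open>4 * a\<close>.\<close>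
  define s where "s = l * a * t / (2 * (4 * a))"
  have cov: "inj_on f (ball c s)" "ball (f c) (l * a * s / 2) \<subseteq> f ` ball c s"
    "continuous_on (ball c s) f"
  proof -
    have sub: "ball c t \<subseteq> unit_disc" using small by blast
    have dh: "norm (deriv h z - deriv h c) < 4 * a" if "z \<in> ball c t" for z
      using norm_triangle_ineq4[of "deriv h z" "deriv h c"] hb[OF that] a1 by (simp add: a_def)
    have dg: "norm (deriv g z - deriv g c) < 4 * a" if "z \<in> ball c t" for z
      using norm_triangle_ineq4[of "deriv g z" "deriv g c"] gb[OF that] gc a1 by simp
    have A0: "0 < l * a" "l * a < 2 * (4 * a)" using l a1 la by auto
    note * = harmonic_inj_and_covers[OF holomorphic_on_subset[OF h sub]
        holomorphic_on_subset[OF g sub] t A0 A dh dg f[OF small(1)] s_def]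
    show "inj_on f (ball c s)" "ball (f c) (l * a * s / 2) \<subseteq> f ` ball c s"
      "continuous_on (ball c s) f" by (rule *; assumption)+
  qed
  have s: "s = l * t / 8" using a1 by (simp add: s_def)
  have "s \<le> t" using l t unfolding s by (simp add: mult_le_cancel_right1)
  then have "ball c s \<subseteq> unit_disc" using small(1) by (meson subset_ball subset_iff)
  then have "schlicht_disc f (f c) (l * a * s / 2)"
    using l a1 t by (intro schlicht_discI[OF cov(1,3) open_ball _ cov(2)]) (auto simp: s)
  \<comment> \<open>The radius equals \<open>l\<^sup>2 * a * t / 16\<close>, and
    \<open>a * t \<ge> 3/8\<close> turns 1/16 into 3/128.\<close>
  moreover have "3 * (1 - k - M)\<^sup>2 / 128 \<le> l * a * s / 2"
  proof -
    have "l\<^sup>2 / 16 * (3/8) \<le> l\<^sup>2 / 16 * (a * t)" using at by (intro mult_left_mono) auto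
    then show ?thesis
      unfolding l_def[symmetric] by (simp add: s power2_eq_square field_simps)
  qed
  ultimately show ?thesis by blast
qed

end
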